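(* For all $m,n,s\in\mathbb{N}$, the graph $LK_{1,m}\cup 2LK_{1,n}\cup (2s)LK_{1,1}$ is super edge-magic.
   Context: Graphs are finite and undirected, may contain loops, but multiple edges are not allowed. $\mathbb{N}$ denotes the positive integers, and for integers $m\le n$, $[m,n]=\{m,m+1,\dots,n\}$. $LK_{1,n}$ is the graph obtained from the star $K_{1,n}$ (one central vertex joined to $n$ other vertices) by attaching a loop at its central vertex (for $n=1$: an edge with a loop at one of its two endpoints). For a positive integer $t$ and a graph $G$, $tG$ denotes the disjoint union of $t$ copies of $G$; $\cup$ denotes disjoint union of graphs. Let $G$ be a graph with $p$ vertices and $q$ edges (loops count as edges). $G$ is edge-magic if there is a bijection $f:V(G)\cup E(G)\to[1,p+q]$ and a constant $k$ such that $f(x)+f(xy)+f(y)=k$ for every edge $xy\in E(G)$ (for a loop, $x=y$). $G$ is super edge-magic if there is such an $f$ with, in addition, $f(V(G))=[1,p]$. It is known that, equivalently, $G$ is super edge-magic if and only if there is a bijection $g:V(G)\to[1,p]$ such that $\{g(u)+g(v):uv\in E(G)\}$ is a set of $q$ consecutive integers (a loop at $u$ contributes $2g(u)$). *)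

theory Defs
  imports Main
begin

text \<open>
  An undirected graph that may have loops but no multiple edges: an edge with endpoints
  \<open>x\<close> and \<open>y\<close> is the set \<open>{x, y}\<close>, so that a loop at \<open>x\<close> is the singleton \<open>{x}\<close>.
\<close>

record 'a lgraph =
  verts :: "'a set"
  edges :: "'a set set"

definition finite_lgraph :: "'a lgraph \<Rightarrow> bool" where
  "finite_lgraph G \<longleftrightarrow>
     finite (verts G) \<and> (\<forall>e\<in>edges G. \<exists>x\<in>verts G. \<exists>y\<in>verts G. e = {x, y})"

definition disjoint_union :: "'a lgraph \<Rightarrow> 'b lgraph \<Rightarrow> ('a + 'b) lgraph" (infixr \<open>\<uplus>\<close> 65) where
  "G \<uplus> H = \<lparr> verts = verts G <+> verts H,
             edges = (\<lambda>e. Inl ` e) ` edges G \<union> (\<lambda>e. Inr ` e) ` edges H \<rparr>"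

definition copies :: "nat \<Rightarrow> 'a lgraph \<Rightarrow> (nat \<times> 'a) lgraph" where
  "copies t G = \<lparr> verts = {1..t} \<times> verts G,
                  edges = (\<Union>i\<in>{1..t}. (\<lambda>e. Pair i ` e) ` edges G) \<rparr>"

text \<open>The graph $LK_{1,n}$; the vertex \<open>0\<close> is the centre of the star.\<close>

definition LK1 :: "nat \<Rightarrow> nat lgraph" where
  "LK1 n = \<lparr> verts = {0..n}, edges = insert {0} {{0, i} | i. i \<in> {1..n}} \<rparr>"

text \<open>
  A labelling \<open>f\<close> lives on the disjoint sum of vertices and edges: \<open>f (Inl x)\<close> is the label of
  the vertex \<open>x\<close> and \<open>f (Inr e)\<close> the label of the edge \<open>e\<close>. For a loop (\<open>x = y\<close>) the label of
  its endpoint is counted twice.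
\<close>

definition edge_magic_labelling :: "'a lgraph \<Rightarrow> ('a + 'a set \<Rightarrow> nat) \<Rightarrow> nat \<Rightarrow> bool" where
  "edge_magic_labelling G f k \<longleftrightarrow>
     bij_betw f (verts G <+> edges G) {1..card (verts G) + card (edges G)} \<and>
     (\<forall>x y. {x, y} \<in> edges G \<longrightarrow> f (Inl x) + f (Inr {x, y}) + f (Inl y) = k)"

definition edge_magic :: "'a lgraph \<Rightarrow> bool" where
  "edge_magic G \<longleftrightarrow> finite_lgraph G \<and> (\<exists>f k. edge_magic_labelling G f k)"

definition super_edge_magic :: "'a lgraph \<Rightarrow> bool" where
  "super_edge_magic G \<longleftrightarrow> finite_lgraph G \<and>
     (\<exists>f k. edge_magic_labelling G f k \<and> f ` Inl ` verts G = {1..card (verts G)})"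

lemma finite_lgraph_disjoint_union:
  assumes "finite_lgraph G" "finite_lgraph H"
  shows "finite_lgraph (G \<uplus> H)"
proof -
  have "\<exists>x\<in>verts (G \<uplus> H). \<exists>y\<in>verts (G \<uplus> H). e = {x, y}" if "e \<in> edges (G \<uplus> H)" for e
  proof -
    from that consider e' where "e' \<in> edges G" "e = Inl ` e'" | e' where "e' \<in> edges H" "e = Inr ` e'"
      by (auto simp: disjoint_union_def)
    then show ?thesis
    proof cases
      case 1
      then obtain x y where "x \<in> verts G" "y \<in> verts G" "e' = {x, y}"
        using assms by (auto simp: finite_lgraph_def)
      with 1 have "Inl x \<in> verts (G \<uplus> H)" "Inl y \<in> verts (G \<uplus> H)" "e = {Inl x, Inl y}"
        by (auto simp: disjoint_union_def)
      then show ?thesis by blast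
    next
      case 2
      then obtain x y where "x \<in> verts H" "y \<in> verts H" "e' = {x, y}"
        using assms by (auto simp: finite_lgraph_def)
      with 2 have "Inr x \<in> verts (G \<uplus> H)" "Inr y \<in> verts (G \<uplus> H)" "e = {Inr x, Inr y}"
        by (auto simp: disjoint_union_def)
      then show ?thesis by blast
    qed
  qed
  moreover have "finite (verts (G \<uplus> H))"
    using assms by (simp add: finite_lgraph_def disjoint_union_def)
  ultimately show ?thesis by (simp add: finite_lgraph_def)
qed

lemma finite_lgraph_copies:
  assumes "finite_lgraph G"
  shows "finite_lgraph (copies t G)"
proof -
  have "\<exists>x\<in>verts (copies t G). \<exists>y\<in>verts (copies t G). e = {x, y}" if "e \<in> edges (copies t G)" for e
  proof -
    from that obtain i e' where i: "i \<in> {1..t}" "e' \<in> edges G" "e = Pair i ` e'"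
      by (auto simp: copies_def)
    then obtain x y where "x \<in> verts G" "y \<in> verts G" "e' = {x, y}"
      using assms by (auto simp: finite_lgraph_def)
    with i have "(i, x) \<in> verts (copies t G)" "(i, y) \<in> verts (copies t G)" "e = {(i, x), (i, y)}"
      by (auto simp: copies_def)
    then show ?thesis by blast
  qed
  moreover have "finite (verts (copies t G))"
    using assms by (simp add: finite_lgraph_def copies_def)
  ultimately show ?thesis by (simp add: finite_lgraph_def)
qed

lemma finite_lgraph_LK1: "finite_lgraph (LK1 n)"
  by (fastforce simp: finite_lgraph_def LK1_def)

end

theory Submission imports Defs begin

text \<open>
  Every component is a star with a loop at its centre, so its edges correspond to its vertices:
  the vertex \<open>v\<close> gives the edge joining \<open>v\<close> to the centre of its component, and the centre gives
  the loop. Hence a super edge-magic labelling amounts to a bijection \<open>g\<close> from the \<open>p\<close> vertices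
  to \<open>{1..p}\<close> such that \<open>v \<mapsto> g (centre v) + g v\<close> is a bijection onto an interval \<open>{k+1..k+p}\<close>
  (\<open>super_edge_magic_if_centre_sums_consecutive\<close>). Subtracting \<open>k\<close>, one needs a permutation of
  \<open>{1..p}\<close> that moves every vertex of a component by the same shift \<open>d = g (centre) - k\<close>.

  Put \<open>h = s + 1\<close> and \<open>k = 2h + 1\<close>, give the \<open>2h + 1\<close> centres the labels \<open>k + d\<close> for
  \<open>-h \<le> d \<le> h\<close>, and measure labels from \<open>k\<close>. The centre at offset \<open>d\<close> moves to \<open>2d\<close>, so centres fill
  the even offsets in \<open>[-2h, 2h]\<close>. A leaf with shift \<open>d > 0\<close> put at offset \<open>-2h + d - 1\<close>
  moves to \<open>-2h + 2d - 1\<close>, and a leaf with shift \<open>-d < 0\<close> put at \<open>2h + 1 - d\<close> moves to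
  \<open>2h + 1 - 2d\<close>; these fill the odd offsets in that interval. So one leaf for each nonzero shift,
  together with all centres, is a permutation of \<open>[-2h, 2h]\<close>.

  The larger stars are accommodated to the right of this core. The shifts \<open>1\<close> and \<open>-1\<close>
  interchange adjacent labels, so the two components with these shifts can receive any
  number \<open>n - 1\<close> of further leaves each; the shift \<open>0\<close> fixes labels, so the component with shift
  \<open>0\<close> can receive any number \<open>m\<close> of leaves. The remaining shifts \<open>\<plusminus>2, \<dots>, \<plusminus>h\<close> belong to the \<open>2s\<close>
  copies of \<open>LK1 1\<close>.
\<close>

text \<open>
  Giving the edges complementary labels turns consecutive edge sums into a constant. The edge sum
  is written as minimum plus maximum so that it is a function of the edge as a set; on a loop both
  coincide, so the label of its endpoint counts twice.
\<close>

lemma super_edge_magic_if_edge_sums_consecutive: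
  fixes g :: "'a \<Rightarrow> nat"
  defines "edge_sum \<equiv> \<lambda>e. Min (g ` e) + Max (g ` e)"
  assumes fin: "finite_lgraph G"
    and g: "bij_betw g (verts G) {1..card (verts G)}"
    and sums: "bij_betw edge_sum (edges G) {k + 1..k + card (edges G)}"
  shows "super_edge_magic G"
proof -
  define p where "p = card (verts G)"
  define q where "q = card (edges G)"
  define K where "K = p + q + k + 1"
  define f where "f = case_sum g (\<lambda>e. K - edge_sum e)"
  have edge_sum_pair: "edge_sum {x, y} = g x + g y" for x y
    by (auto simp: edge_sum_def min_def max_def)
  have sum_in: "edge_sum e \<in> {k + 1..k + q}" if "e \<in> edges G" for e
    using sums that by (auto simp: bij_betw_def q_def)
  have "bij_betw (\<lambda>t. K - t) {k + 1..k + q} {p + 1..p + q}"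
    by (rule bij_betw_byWitness[where f' = "\<lambda>t. K - t"]) (auto simp: K_def)
  then have edge_labels: "bij_betw (\<lambda>e. K - edge_sum e) (edges G) {p + 1..p + q}"
    using bij_betw_trans[OF sums[folded q_def]] by (simp add: comp_def)
  have vertex_image: "f ` Inl ` verts G = {1..p}"
    using g by (simp add: f_def image_image bij_betw_def p_def)
  have edge_image: "f ` Inr ` edges G = {p + 1..p + q}"
    using edge_labels by (simp add: f_def image_image bij_betw_def)
  have "bij_betw f (Inl ` verts G \<union> Inr ` edges G) ({1..p} \<union> {p + 1..p + q})"
  proof (rule bij_betw_combine)
    show "bij_betw f (Inl ` verts G) {1..p}"
      using g vertex_image by (auto simp: bij_betw_def inj_on_def f_def)
    show "bij_betw f (Inr ` edges G) {p + 1..p + q}"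
      using edge_labels edge_image by (auto simp: bij_betw_def inj_on_def f_def)
  qed auto
  moreover have "{1..p} \<union> {p + 1..p + q} = {1..p + q}"
    by auto
  ultimately have "bij_betw f (verts G <+> edges G) {1..p + q}"
    by (simp add: Plus_def)
  moreover have "f (Inl x) + f (Inr {x, y}) + f (Inl y) = K" if "{x, y} \<in> edges G" for x y
    using sum_in[OF that] by (simp add: f_def edge_sum_pair K_def)
  ultimately have "edge_magic_labelling G f K"
    by (simp add: edge_magic_labelling_def p_def q_def)
  with fin vertex_image show ?thesis
    by (auto simp: super_edge_magic_def p_def)
qed

lemma bij_betw_if_inj_on_interval:
  fixes h :: "'a \<Rightarrow> nat"
  assumes "inj_on h A" "h ` A \<subseteq> {k + 1..k + card A}"
  shows "bij_betw h A {k + 1..k + card A}"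
  using assms card_subset_eq[OF _ assms(2)] by (simp add: bij_betw_def card_image)

text \<open>
  When every edge is named by one of its vertices, the edge sums become a function on vertices.
  Injectivity of that function makes the naming of edges unambiguous, so there are as many edges
  as vertices, and by counting it suffices that labels and sums are injective and stay in range.
\<close>

lemma super_edge_magic_if_centre_sums_consecutive:
  fixes g :: "'a \<Rightarrow> nat" and centre :: "'a \<Rightarrow> 'a"
  defines "centre_sum \<equiv> \<lambda>v. g (centre v) + g v"
  assumes fin: "finite_lgraph G"
    and edges: "edges G = (\<lambda>v. {centre v, v}) ` verts G"
    and g: "inj_on g (verts G)" "g ` verts G \<subseteq> {1..card (verts G)}"
    and sums: "inj_on centre_sum (verts G)" "centre_sum ` verts G \<subseteq> {k + 1..k + card (verts G)}"
  shows "super_edge_magic G"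
proof (rule super_edge_magic_if_edge_sums_consecutive[OF fin])
  let ?edge_sum = "\<lambda>e. Min (g ` e) + Max (g ` e)"
  let ?e = "\<lambda>v. {centre v, v}"
  have comp: "?edge_sum \<circ> ?e = centre_sum"
    by (auto simp: centre_sum_def min_def max_def)
  have "inj_on ?e (verts G)"
    using sums(1) unfolding comp[symmetric] by (rule inj_on_imageI2)
  then have "bij_betw ?e (verts G) (edges G)"
    by (simp add: bij_betw_def edges)
  moreover from this have "card (edges G) = card (verts G)"
    by (simp add: bij_betw_same_card)
  moreover have "bij_betw centre_sum (verts G) {k + 1..k + card (verts G)}"
    using sums by (rule bij_betw_if_inj_on_interval)
  ultimately show "bij_betw ?edge_sum (edges G) {k + 1..k + card (edges G)}"
    using comp bij_betw_comp_iff[of ?e "verts G" "edges G" ?edge_sum] by simp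
  show "bij_betw g (verts G) {1..card (verts G)}"
    using bij_betw_if_inj_on_interval[of g _ 0] g by simp
qed

lemma inj_on_Plus:
  "inj_on h (A <+> B) \<longleftrightarrow> inj_on (\<lambda>a. h (Inl a)) A \<and> inj_on (\<lambda>b. h (Inr b)) B \<and>
    (\<forall>a\<in>A. \<forall>b\<in>B. h (Inl a) \<noteq> h (Inr b))"
  by (fastforce simp: inj_on_def)

lemma parity_clash: "a = b \<Longrightarrow> even a \<noteq> even b \<Longrightarrow> False" for a b :: nat
  by simp

lemma edges_LK1: "edges (LK1 n) = (\<lambda>v. {0, v}) ` verts (LK1 n)"
  by (fastforce simp: LK1_def)

lemma edges_copies:
  assumes "edges G = (\<lambda>v. {c v, v}) ` verts G"
  shows "edges (copies t G) = (\<lambda>v. {apsnd c v, v}) ` verts (copies t G)"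
proof -
  have "{1..t} \<times> verts G = (\<Union>i\<in>{1..t}. Pair i ` verts G)"
    by auto
  then show ?thesis
    by (simp add: copies_def assms image_image image_UN)
qed

lemma edges_disjoint_union:
  assumes "edges G = (\<lambda>v. {c v, v}) ` verts G" "edges H = (\<lambda>v. {d v, v}) ` verts H"
  shows "edges (G \<uplus> H) = (\<lambda>v. {map_sum c d v, v}) ` verts (G \<uplus> H)"
  by (simp add: disjoint_union_def assms Plus_def image_Un image_image)

text \<open>
  With \<open>k = 2s + 3\<close>, the shifts are \<open>0\<close> for \<open>LK1 m\<close>, \<open>-1\<close> and \<open>1\<close> for the first and second copy of
  \<open>LK1 n\<close>, \<open>i - s - 2\<close> for the copies \<open>i \<le> s\<close> of \<open>LK1 1\<close>, and \<open>i - s + 1\<close> for its copies \<open>i > s\<close>.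
  The core ends at the label \<open>4s + 5\<close>.
\<close>

fun label :: "nat \<Rightarrow> nat \<Rightarrow> nat + nat \<times> nat + nat \<times> nat \<Rightarrow> nat" where
  "label n s (Inl v) = (if v = 0 then 2 * s + 3 else 4 * s + 3 + 2 * n + v)"
| "label n s (Inr (Inl (i, v))) =
    (if i = 1 then if v = 0 then 2 * s + 2 else 4 * s + 3 + 2 * v
     else if v = 0 then 2 * s + 4 else if v = 1 then 1 else 4 * s + 2 + 2 * v)"
| "label n s (Inr (Inr (i, v))) =
    (if i \<le> s then if v = 0 then s + 1 + i else 3 * s + 4 + i
     else if v = 0 then s + 4 + i else i + 1 - s)"

theorem theorem2p4:
  fixes m n s :: nat
  assumes "m \<ge> 1" and "n \<ge> 1" and "s \<ge> 1"
  shows "super_edge_magic (LK1 m \<uplus> copies 2 (LK1 n) \<uplus> copies (2 * s) (LK1 1))"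
    (is "super_edge_magic ?G")
proof (rule super_edge_magic_if_centre_sums_consecutive)
  let ?to_centre = "\<lambda>_ :: nat. 0 :: nat"
  let ?centre = "map_sum ?to_centre (map_sum (apsnd ?to_centre) (apsnd ?to_centre))"
  have verts: "verts ?G = {0..m} <+> ({1..2} \<times> {0..n}) <+> ({1..2 * s} \<times> {0..1})"
    by (simp add: disjoint_union_def copies_def LK1_def)
  have card: "card (verts ?G) = m + 2 * n + 4 * s + 3"
    unfolding verts by (simp add: card_Plus)
  show "finite_lgraph ?G"
    by (intro finite_lgraph_disjoint_union finite_lgraph_copies finite_lgraph_LK1)
  show "edges ?G = (\<lambda>v. {?centre v, v}) ` verts ?G"
    by (intro edges_disjoint_union edges_copies edges_LK1)
  show "label n s ` verts ?G \<subseteq> {1..card (verts ?G)}"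
    using assms unfolding card unfolding verts by auto
  show "(\<lambda>v. label n s (?centre v) + label n s v) ` verts ?G
    \<subseteq> {2 * s + 3 + 1..2 * s + 3 + card (verts ?G)}"
    using assms unfolding card unfolding verts by auto
  (* Any two formulas for a label, and likewise for a sum, differ in size or in parity. *)
  show "inj_on (label n s) (verts ?G)"
    unfolding verts inj_on_Plus
    by (insert assms, intro conjI; auto simp: inj_on_def split: if_splits;
      (linarith | (erule parity_clash, auto)))
  show "inj_on (\<lambda>v. label n s (?centre v) + label n s v) (verts ?G)"
    unfolding verts inj_on_Plus
    by (insert assms, intro conjI; auto simp: inj_on_def split: if_splits;
      (linarith | (erule parity_clash, auto)))
qed

end
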